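(* The positive integers that are expressible as a sum of successive even positive numbers and are not expressible as a sum of successive odd positive numbers are exactly the even numbers of the form $2\cdot(2m+1)$, where $m$ is a positive integer.
   Context: A sum of successive odd (respectively even) positive numbers is a sum $a+(a+2)+(a+4)+\cdots+(a+2(r-1))$ with $r\ge 2$ terms, where $a$ is an odd (respectively even) positive integer. *)

theory Defs
  imports Main
begin

definition sum_successive_odd :: "nat \<Rightarrow> bool" where
  "sum_successive_odd n \<longleftrightarrow>
     (\<exists>a r. 0 < a \<and> odd a \<and> 2 \<le> r \<and> n = (\<Sum>i<r. a + 2 * i))"

definition sum_successive_even :: "nat \<Rightarrow> bool" where
  "sum_successive_even n \<longleftrightarrow>
     (\<exists>a r. 0 < a \<and> even a \<and> 2 \<le> r \<and> n = (\<Sum>i<r. a + 2 * i))"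

end

theory Submission
  imports Defs
begin

text \<open>
  A progression of \<open>k + 1\<close> terms with step 2 starting at \<open>a\<close> has the sum \<open>(k + 1) * (a + k)\<close>.
  The parity of \<open>a\<close> decides whether these two factors have equal or opposite parity. For odd
  \<open>a\<close> they have equal parity, so the sum is odd or divisible by 4; hence no number congruent
  to 2 modulo 4 is a sum of successive odd numbers. For even \<open>a\<close> they have opposite parity, so
  the sum is even.

  Two terms suffice for all the representations needed: \<open>a + (a + 2) = 2 * (a + 1)\<close>
  reaches every multiple of 4 with \<open>a\<close> odd, and every \<open>2 * (2 * m + 1)\<close> with \<open>a = 2 * m\<close>.
  What remains of the sums of successive even numbers is therefore the class of 2 modulo 4,
  without the number 2 itself, because the smallest such sum is \<open>2 + 4\<close>.
\<close>

lemma sum_step_two: "(\<Sum>i<Suc k. a + 2 * i) = Suc k * (a + k)" for a k :: nat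
  by (induction k) (auto simp: algebra_simps)

text \<open>Taking the number of terms as \<open>Suc k\<close> keeps truncated subtraction out of the product.\<close>

lemma ex_progression_iff:
  "(\<exists>a r. 0 < a \<and> P a \<and> 2 \<le> r \<and> n = (\<Sum>i<r. a + 2 * i)) \<longleftrightarrow>
     (\<exists>a k. 0 < a \<and> P a \<and> 0 < k \<and> n = Suc k * (a + k))" for n :: nat
proof
  assume "\<exists>a r. 0 < a \<and> P a \<and> 2 \<le> r \<and> n = (\<Sum>i<r. a + 2 * i)"
  then obtain a r where *: "0 < a" "P a" "2 \<le> r" "n = (\<Sum>i<r. a + 2 * i)"
    by blast
  from \<open>2 \<le> r\<close> obtain k where "r = Suc k" "0 < k"
    by (cases r) auto
  with * show "\<exists>a k. 0 < a \<and> P a \<and> 0 < k \<and> n = Suc k * (a + k)"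
    using sum_step_two by metis
next
  assume "\<exists>a k. 0 < a \<and> P a \<and> 0 < k \<and> n = Suc k * (a + k)"
  then obtain a k where *: "0 < a" "P a" "0 < k" "n = Suc k * (a + k)"
    by blast
  then have "2 \<le> Suc k" "n = (\<Sum>i<Suc k. a + 2 * i)"
    by (simp_all only: sum_step_two)
  with * show "\<exists>a r. 0 < a \<and> P a \<and> 2 \<le> r \<and> n = (\<Sum>i<r. a + 2 * i)"
    by blast
qed

lemmas sum_successive_odd_iff = ex_progression_iff[of odd, folded sum_successive_odd_def]
lemmas sum_successive_even_iff = ex_progression_iff[of even, folded sum_successive_even_def]

text \<open>The factors \<open>Suc k\<close> and \<open>a + k\<close> have equal parity when \<open>a\<close> is odd.\<close>

lemma sum_successive_odd_imp_odd_or_4_dvd: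
  assumes "sum_successive_odd n"
  shows "odd n \<or> 4 dvd n"
proof -
  from assms obtain a k where "odd a" and n: "n = Suc k * (a + k)"
    unfolding sum_successive_odd_iff by blast
  show ?thesis
  proof (cases "even k")
    case True
    with \<open>odd a\<close> show ?thesis by (simp add: n)
  next
    case False
    with \<open>odd a\<close> have "2 dvd Suc k" "2 dvd a + k" by simp_all
    then have "2 * 2 dvd Suc k * (a + k)" by (rule mult_dvd_mono)
    then show ?thesis by (simp add: n)
  qed
qed

lemma sum_successive_odd_if_4_dvd:
  assumes "0 < n" "4 dvd n"
  shows "sum_successive_odd n"
proof -
  from assms obtain j where "n = 4 * Suc j"
    by (metis dvd_def mult_0_right not0_implies_Suc less_irrefl)
  then have "n = Suc 1 * ((2 * j + 1) + 1)" by simp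
  moreover have "odd (2 * j + 1)" "0 < 2 * j + 1" by simp_all
  ultimately show ?thesis
    unfolding sum_successive_odd_iff by (metis zero_less_one)
qed

text \<open>The factors \<open>Suc k\<close> and \<open>a + k\<close> have opposite parity when \<open>a\<close> is even, and they are at
  least 2 and 3.\<close>

lemma sum_successive_even_imp:
  assumes "sum_successive_even n"
  shows "even n" and "6 \<le> n"
proof -
  from assms obtain a k where a: "0 < a" "even a" and "0 < k" and n: "n = Suc k * (a + k)"
    unfolding sum_successive_even_iff by blast
  from \<open>even a\<close> show "even n" by (simp add: n)
  from a have "2 \<le> a" by (auto elim!: evenE)
  with \<open>0 < k\<close> have "2 * 3 \<le> Suc k * (a + k)" by (intro mult_le_mono) simp_all
  then show "6 \<le> n" by (simp add: n)
qed

lemma sum_successive_even_twice_odd: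
  assumes "0 < m"
  shows "sum_successive_even (2 * (2 * m + 1))"
proof -
  have "2 * (2 * m + 1) = Suc 1 * (2 * m + 1)" by simp
  moreover have "even (2 * m)" "0 < 2 * m" using assms by simp_all
  ultimately show ?thesis
    unfolding sum_successive_even_iff by (metis zero_less_one)
qed

theorem mainTheorem4:
  "{n :: nat. 0 < n \<and> sum_successive_even n \<and> \<not> sum_successive_odd n}
     = {2 * (2 * m + 1) | m :: nat. 0 < m}"
proof (intro set_eqI iffI)
  fix n :: nat
  assume "n \<in> {n. 0 < n \<and> sum_successive_even n \<and> \<not> sum_successive_odd n}"
  then have "even n" "6 \<le> n" "\<not> 4 dvd n"
    using sum_successive_even_imp sum_successive_odd_if_4_dvd by auto
  then have "n = 2 * (2 * (n div 4) + 1)" "0 < n div 4"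
    by presburger+
  then show "n \<in> {2 * (2 * m + 1) | m. 0 < m}"
    by blast
next
  fix n :: nat
  assume "n \<in> {2 * (2 * m + 1) | m. 0 < m}"
  then obtain m where m: "0 < m" "n = 2 * (2 * m + 1)"
    by blast
  then have "even n" "\<not> 4 dvd n"
    by presburger+
  then have "\<not> sum_successive_odd n"
    using sum_successive_odd_imp_odd_or_4_dvd by blast
  with m sum_successive_even_twice_odd
  show "n \<in> {n. 0 < n \<and> sum_successive_even n \<and> \<not> sum_successive_odd n}"
    by auto
qed

end
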